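(* Let $\Lambda_\pm:\mathbb R\to\mathbb R$ be initial data as in the context, with $\Lambda_-(x)<\Lambda_+(x)$, $\Lambda_-'(x)<0$ and $\Lambda_+'(x)<0$ for all $x\in\mathbb R$. Let $\alpha_0<\beta_0$ be such that $\Lambda_-(\alpha_0)=\Lambda_+(\beta_0)$, $f(\alpha_0)=0$ and $f'(\alpha_0)<0$, with $f$ as in the context. Let $(t_0,x_0)$ and the solution $(\rho,u)$ on $[0,t_0)\times\mathbb R$ be as in the context. Then for every $\phi\in C_0^1(\mathbb R^+\times\mathbb R)$, $$\lim_{\epsilon\to0}\iint_{D_\epsilon^-}\big(\rho\,\phi_t+\rho u\,\phi_x\big)\,dx\,dt=0\qquad\text{and}\qquad \lim_{\epsilon\to0}\iint_{D_\epsilon^-}\big(\rho u\,\phi_t+(\rho u^2+p)\,\phi_x\big)\,dx\,dt=0,$$ where $D_\epsilon^-=\{(t,x): |x-x_0|\le\epsilon,\ t_0-\epsilon\le t\le t_0\}$.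
   Context: Chaplygin gas: $\partial_t\rho+\partial_x(\rho u)=0$, $\partial_t(\rho u)+\partial_x(\rho u^2+p)=0$, $p=p_0-\mu^2/\rho$, with constants $p_0,\mu>0$ and initial data $\rho(0,x)=\rho_0(x)>0$, $u(0,x)=u_0(x)$. Set $\Lambda_\pm=u_0\pm\mu/\rho_0$; the data $\rho_0,u_0,\Lambda_\pm$ are of class $C^2$ with bounded $C^2$ norm. The Riemann invariants $\lambda_\pm=u\pm\mu/\rho$ satisfy $\partial_t\lambda_-+\lambda_+\partial_x\lambda_-=0$, $\partial_t\lambda_++\lambda_-\partial_x\lambda_+=0$, $\lambda_\pm(0,x)=\Lambda_\pm(x)$, and $u=(\lambda_++\lambda_-)/2$, $\rho=2\mu/(\lambda_+-\lambda_-)$. For $\alpha$ with $\Lambda_-(\alpha)\in\Lambda_+(\mathbb R)$ let $\beta(\alpha)=\Lambda_+^{-1}(\Lambda_-(\alpha))$ (so $\beta(\alpha_0)=\beta_0$) and $$f(\alpha)=\frac{\Lambda_-'(\alpha)}{\Lambda_+(\beta(\alpha))-\Lambda_-(\beta(\alpha))}-\frac{\Lambda_+'(\beta(\alpha))}{\Lambda_+(\alpha)-\Lambda_-(\alpha)}.$$ $$t_0=\int_{\alpha_0}^{\beta_0}\frac{d\zeta}{\Lambda_+(\zeta)-\Lambda_-(\zeta)},\qquad x_0=\frac12\left\{\alpha_0+\beta_0+\int_{\alpha_0}^{\beta_0}\frac{\Lambda_+(\zeta)+\Lambda_-(\zeta)}{\Lambda_+(\zeta)-\Lambda_-(\zeta)}\,d\zeta\right\}.$$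 Standing assumption: the $C^1$ solution $(\lambda_-,\lambda_+)$ exists on $[0,t_0)\times\mathbb R$; it is the solution constructed by characteristics (constant $\lambda_+$ along $dx/dt=\lambda_-$, constant $\lambda_-$ along $dx/dt=\lambda_+$), and $(\rho,u)$ is the corresponding solution. $C_0^1(\mathbb R^+\times\mathbb R)$ denotes the $C^1$ functions vanishing outside a compact subset of $\{t\ge0\}$. *)

theory Defs
  imports "HOL-Analysis.Analysis"
begin

text \<open>Points of the half plane are pairs \<open>(t, x)\<close>, time first;
  \<open>lm\<close>, \<open>lp\<close> stand for the Riemann invariants \<open>\<lambda>\<^sub>-\<close>, \<open>\<lambda>\<^sub>+\<close>.\<close>

definition C2_bounded :: "(real \<Rightarrow> real) \<Rightarrow> bool" where
  "C2_bounded g \<longleftrightarrow>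
     (\<forall>x. g field_differentiable (at x)) \<and>
     (\<forall>x. deriv g field_differentiable (at x)) \<and>
     continuous_on UNIV (deriv (deriv g)) \<and>
     bounded (range g) \<and> bounded (range (deriv g)) \<and> bounded (range (deriv (deriv g)))"

text \<open>
  The function \<open>w\<close> is \<open>C\<^sup>1\<close> on \<open>S\<close> with partial derivatives \<open>wt = \<partial>\<^sub>t w\<close> and \<open>wx = \<partial>\<^sub>x w\<close>.
  All derivatives are taken within \<open>S\<close>, hence one-sided in time at \<open>t = 0\<close>
  when \<open>S\<close> is \<open>[0,T) \<times> \<real>\<close> or \<open>[0,\<infinity>) \<times> \<real>\<close>.
\<close>
definition C1_on :: "(real \<times> real) set \<Rightarrow> (real \<times> real \<Rightarrow> real) \<Rightarrow> (real \<times> real \<Rightarrow> real)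
    \<Rightarrow> (real \<times> real \<Rightarrow> real) \<Rightarrow> bool" where
  "C1_on S w wt wx \<longleftrightarrow>
     continuous_on S wt \<and> continuous_on S wx \<and>
     (\<forall>z\<in>S. (w has_derivative (\<lambda>h. wt z * fst h + wx z * snd h)) (at z within S))"

definition test_function :: "(real \<times> real \<Rightarrow> real) \<Rightarrow> (real \<times> real \<Rightarrow> real)
    \<Rightarrow> (real \<times> real \<Rightarrow> real) \<Rightarrow> bool" where
  "test_function \<phi> \<phi>t \<phi>x \<longleftrightarrow>
     C1_on ({0..} \<times> UNIV) \<phi> \<phi>t \<phi>x \<and>
     (\<exists>K. compact K \<and> K \<subseteq> {0..} \<times> UNIV \<and> (\<forall>z \<in> {0..} \<times> UNIV - K. \<phi> z = 0))"

text \<open>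
  \<open>(t, x)\<close> is joined to the initial line by an integral curve of \<open>dx/dt = v\<close>
  along which \<open>w\<close> keeps the value that the initial datum \<open>W\<close> has at its foot.
\<close>
definition carried_along :: "(real \<times> real \<Rightarrow> real) \<Rightarrow> (real \<times> real \<Rightarrow> real) \<Rightarrow> (real \<Rightarrow> real)
    \<Rightarrow> real \<Rightarrow> real \<Rightarrow> bool" where
  "carried_along v w W t x \<longleftrightarrow>
     (\<exists>X. X t = x \<and>
        (\<forall>s\<in>{0..t}. (X has_real_derivative v (s, X s)) (at s within {0..t}) \<and>
                     w (s, X s) = W (X 0)))"

text \<open>
  The last conjunct expresses that the solution is the one constructed by characteristics;
  \<open>C\<^sup>1\<close> solutions are not assumed bounded, so the existence of
  characteristics down to \<open>t = 0\<close> does not follow from the equations.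
\<close>
definition riemann_invariants_solution :: "(real \<Rightarrow> real) \<Rightarrow> (real \<Rightarrow> real) \<Rightarrow> real
    \<Rightarrow> (real \<times> real \<Rightarrow> real) \<Rightarrow> (real \<times> real \<Rightarrow> real) \<Rightarrow> bool" where
  "riemann_invariants_solution \<Lambda>m \<Lambda>p T lm lp \<longleftrightarrow>
     (\<exists>mt mx pt px.
        C1_on ({0..<T} \<times> UNIV) lm mt mx \<and> C1_on ({0..<T} \<times> UNIV) lp pt px \<and>
        (\<forall>z \<in> {0..<T} \<times> UNIV. mt z + lp z * mx z = 0 \<and> pt z + lm z * px z = 0)) \<and>
     (\<forall>x. lm (0, x) = \<Lambda>m x \<and> lp (0, x) = \<Lambda>p x) \<and>
     (\<forall>t\<in>{0..<T}. \<forall>x. carried_along lp lm \<Lambda>m t x \<and> carried_along lm lp \<Lambda>p t x)"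

definition gas_density :: "real \<Rightarrow> (real \<times> real \<Rightarrow> real) \<Rightarrow> (real \<times> real \<Rightarrow> real) \<Rightarrow> real \<times> real \<Rightarrow> real" where
  "gas_density \<mu> lm lp z = 2 * \<mu> / (lp z - lm z)"

definition velocity :: "(real \<times> real \<Rightarrow> real) \<Rightarrow> (real \<times> real \<Rightarrow> real) \<Rightarrow> real \<times> real \<Rightarrow> real" where
  "velocity lm lp z = (lp z + lm z) / 2"

definition pressure :: "real \<Rightarrow> real \<Rightarrow> real \<Rightarrow> real" where
  "pressure p0 \<mu> r = p0 - \<mu>\<^sup>2 / r"

text \<open>Meaningful only for \<open>\<Lambda>p\<close> injective and \<open>\<Lambda>m \<alpha> \<in> range \<Lambda>p\<close>.\<close>
definition beta :: "(real \<Rightarrow> real) \<Rightarrow> (real \<Rightarrow> real) \<Rightarrow> real \<Rightarrow> real" where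
  "beta \<Lambda>m \<Lambda>p \<alpha> = inv \<Lambda>p (\<Lambda>m \<alpha>)"

definition blowup_fun :: "(real \<Rightarrow> real) \<Rightarrow> (real \<Rightarrow> real) \<Rightarrow> real \<Rightarrow> real" where
  "blowup_fun \<Lambda>m \<Lambda>p \<alpha> =
     deriv \<Lambda>m \<alpha> / (\<Lambda>p (beta \<Lambda>m \<Lambda>p \<alpha>) - \<Lambda>m (beta \<Lambda>m \<Lambda>p \<alpha>))
     - deriv \<Lambda>p (beta \<Lambda>m \<Lambda>p \<alpha>) / (\<Lambda>p \<alpha> - \<Lambda>m \<alpha>)"

definition blowup_time :: "(real \<Rightarrow> real) \<Rightarrow> (real \<Rightarrow> real) \<Rightarrow> real \<Rightarrow> real \<Rightarrow> real" where
  "blowup_time \<Lambda>m \<Lambda>p \<alpha> \<beta> = integral {\<alpha>..\<beta>} (\<lambda>\<zeta>. 1 / (\<Lambda>p \<zeta> - \<Lambda>m \<zeta>))"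

definition blowup_place :: "(real \<Rightarrow> real) \<Rightarrow> (real \<Rightarrow> real) \<Rightarrow> real \<Rightarrow> real \<Rightarrow> real" where
  "blowup_place \<Lambda>m \<Lambda>p \<alpha> \<beta> =
     (\<alpha> + \<beta> + integral {\<alpha>..\<beta>} (\<lambda>\<zeta>. (\<Lambda>p \<zeta> + \<Lambda>m \<zeta>) / (\<Lambda>p \<zeta> - \<Lambda>m \<zeta>))) / 2"

definition D_minus :: "real \<Rightarrow> real \<Rightarrow> real \<Rightarrow> (real \<times> real) set" where
  "D_minus t0 x0 \<epsilon> = {(t, x). \<bar>x - x0\<bar> \<le> \<epsilon> \<and> t0 - \<epsilon> \<le> t \<and> t \<le> t0}"

text \<open>
  \<open>\<integral>\<integral>\<^bsub>D\<^esub> g \<rightarrow> 0\<close> as \<open>\<epsilon> \<rightarrow> 0+\<close>. Integrability is stated separately because the Bochner integral of a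
  non-integrable function is \<open>0\<close> by convention. The measure is the completed one since the solution is
  only defined for \<open>t < t0\<close>, so the integrands are arbitrary on the null set \<open>t = t0\<close>.
\<close>
definition integrals_vanish :: "(real \<Rightarrow> (real \<times> real) set) \<Rightarrow> (real \<times> real \<Rightarrow> real) \<Rightarrow> bool" where
  "integrals_vanish D g \<longleftrightarrow>
     (\<forall>\<^sub>F \<epsilon> in at_right 0. set_integrable lebesgue (D \<epsilon>) g) \<and>
     ((\<lambda>\<epsilon>. LINT z:D \<epsilon>|lebesgue. g z) \<longlongrightarrow> 0) (at_right 0)"

end

theory Submission
  imports Defs
begin

text \<open>
  The density of a Chaplygin gas may become infinite at the blow-up point, but it cannot put
  much mass near that point: before \<open>t0\<close> the gas is a classical solution, so mass is
  conserved, and since the velocity is bounded by the data, \<open>\<bar>u\<bar> \<le> B\<close>, the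
  mass in a fixed neighbourhood of \<open>x0\<close> at any time \<open>t < t0\<close> is at most
  the mass that initially lay in the domain of dependence of that neighbourhood under speed
  \<open>B\<close>. This bound \<open>M\<close> does not depend on \<open>t\<close>
  (\<open>mass_in_shrinking_interval\<close>).

  Because \<open>\<mu>\<^sup>2 / \<rho> = \<mu> (\<lambda>\<^sub>+ - \<lambda>\<^sub>-) / 2\<close> is bounded, both integrands
  are dominated by a multiple of \<open>1 + \<rho>\<close>. Integrating first in space and then over a time
  interval of length \<open>\<epsilon>\<close> gives integrals of order \<open>\<epsilon>\<close>
  (\<open>integrals_vanish_of_slice_bound\<close>).

  All this needs \<open>\<rho>\<close> to be finite and positive for \<open>t < t0\<close>, that is,
  \<open>\<lambda>\<^sub>- < \<lambda>\<^sub>+\<close>. The gap \<open>\<lambda>\<^sub>+ - \<lambda>\<^sub>-\<close> satisfies a homogeneous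
  linear differential equation along each characteristic, with a coefficient that is continuous
  as long as the solution is \<open>C\<^sup>1\<close>, so it keeps the sign of its initial value
  (\<open>riemann_invariants_strict\<close>).
\<close>

section \<open>Functions of class \<open>C\<^sup>1\<close>\<close>

lemma C1_on_continuous_on: "C1_on S w wt wx \<Longrightarrow> continuous_on S w"
  unfolding C1_on_def by (auto intro!: has_derivative_continuous_on)

lemma C1_on_along_curve:
  fixes X Y :: "real \<Rightarrow> real"
  assumes w: "C1_on S w wt wx"
    and X: "(X has_real_derivative a) (at s within I)"
    and Y: "(Y has_real_derivative b) (at s within I)"
    and sub: "\<And>s. s \<in> I \<Longrightarrow> (X s, Y s) \<in> S" and s: "s \<in> I"
  shows "((\<lambda>s. w (X s, Y s)) has_real_derivative wt (X s, Y s) * a + wx (X s, Y s) * b) (at s within I)"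
proof -
  have XY: "((\<lambda>s. (X s, Y s)) has_derivative (\<lambda>h. (a * h, b * h))) (at s within I)"
    using X Y by (intro has_derivative_Pair) (auto simp: has_field_derivative_def)
  have "((\<lambda>s. w (X s, Y s)) has_derivative
      (\<lambda>h. wt (X s, Y s) * fst (a * h, b * h) + wx (X s, Y s) * snd (a * h, b * h))) (at s within I)"
    using w sub s unfolding C1_on_def
    by (intro has_derivative_in_compose2[OF _ _ _ XY, where t = S]) auto
  then show ?thesis
    unfolding has_field_derivative_def by (rule has_derivative_eq_rhs) (auto simp: algebra_simps)
qed

section \<open>The Riemann invariants stay ordered\<close>

text \<open>A homogeneous linear equation cannot change the sign of a solution:
  \<open>y\<close> is its initial value times the exponential of an integral of \<open>k\<close>.\<close>

lemma linear_ode_positive: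
  fixes y k :: "real \<Rightarrow> real"
  assumes k: "continuous_on {0..t} k" and t: "0 \<le> t"
    and y: "\<And>s. s \<in> {0..t} \<Longrightarrow> (y has_real_derivative k s * y s) (at s within {0..t})"
    and y0: "0 < y 0"
  shows "0 < y t"
proof -
  define K where "K s = integral {0..s} k" for s
  have K: "(K has_real_derivative k s) (at s within {0..t})" if "s \<in> {0..t}" for s
    unfolding K_def using integral_has_real_derivative[OF k that] .
  have "\<exists>c. \<forall>s\<in>{0..t}. y s * exp (- K s) = c"
  proof (rule has_field_derivative_zero_constant)
    fix s assume s: "s \<in> {0..t}"
    show "((\<lambda>s. y s * exp (- K s)) has_field_derivative 0) (at s within {0..t})"
      by (rule derivative_eq_intros y[OF s] K[OF s] refl | simp add: algebra_simps)+
  qed simp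
  then have "y t * exp (- K t) = y 0 * exp (- K 0)" using t by force
  moreover have "0 < y 0 * exp (- K 0)" using y0 by simp
  ultimately show ?thesis by (metis exp_gt_zero zero_less_mult_pos2)
qed

text \<open>Along a curve of speed \<open>\<lambda>\<^sub>-\<close> the invariant \<open>\<lambda>\<^sub>+\<close> is constant, so the
  gap \<open>w = \<lambda>\<^sub>+ - \<lambda>\<^sub>-\<close> satisfies \<open>dw/dt = (\<partial>\<^sub>x \<lambda>\<^sub>-) w\<close>.\<close>

lemma riemann_invariants_strict:
  assumes sol: "riemann_invariants_solution \<Lambda>m \<Lambda>p T lm lp"
    and data: "\<And>x. \<Lambda>m x < \<Lambda>p x" and z: "z \<in> {0..<T} \<times> UNIV"
  shows "lm z < lp z"
proof -
  let ?S = "{0..<T} \<times> (UNIV :: real set)"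
  obtain t x where tx: "z = (t, x)" "0 \<le> t" "t < T" using z by auto
  obtain mt mx pt px where m: "C1_on ?S lm mt mx" and p: "C1_on ?S lp pt px"
    and pde: "\<And>z. z \<in> ?S \<Longrightarrow> mt z + lp z * mx z = 0 \<and> pt z + lm z * px z = 0"
    using sol unfolding riemann_invariants_solution_def by blast
  have "carried_along lm lp \<Lambda>p t x"
    using sol tx unfolding riemann_invariants_solution_def by auto
  then obtain X where Xt: "X t = x"
    and X: "\<And>s. s \<in> {0..t} \<Longrightarrow> (X has_real_derivative lm (s, X s)) (at s within {0..t})"
    unfolding carried_along_def by blast
  have inS: "(s, X s) \<in> ?S" if "s \<in> {0..t}" for s using that tx by auto
  have contX: "continuous_on {0..t} X"
    using X by (rule DERIV_continuous_on)
  have "0 < lp (t, X t) - lm (t, X t)"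
  proof (rule linear_ode_positive[where k = "\<lambda>s. mx (s, X s)" and t = t
        and y = "\<lambda>s. lp (s, X s) - lm (s, X s)"])
    have "continuous_on ?S mx" using m unfolding C1_on_def by blast
    then show "continuous_on {0..t} (\<lambda>s. mx (s, X s))"
      by (rule continuous_on_compose2) (use inS in \<open>auto intro!: continuous_intros contX\<close>)
    fix s assume s: "s \<in> {0..t}"
    have "((\<lambda>s. lp (s, X s) - lm (s, X s)) has_real_derivative
       (pt (s, X s) * 1 + px (s, X s) * lm (s, X s)) - (mt (s, X s) * 1 + mx (s, X s) * lm (s, X s)))
       (at s within {0..t})"
      by (intro DERIV_diff C1_on_along_curve[OF m _ X[OF s]] C1_on_along_curve[OF p _ X[OF s]]
          inS s DERIV_ident)
    moreover have "(pt (s, X s) * 1 + px (s, X s) * lm (s, X s))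
        - (mt (s, X s) * 1 + mx (s, X s) * lm (s, X s))
        = mx (s, X s) * (lp (s, X s) - lm (s, X s))"
      using pde[OF inS[OF s]] by (simp add: algebra_simps)
    ultimately show "((\<lambda>s. lp (s, X s) - lm (s, X s)) has_real_derivative
        mx (s, X s) * (lp (s, X s) - lm (s, X s))) (at s within {0..t})" by simp
  next
    show "0 < lp (0, X 0) - lm (0, X 0)"
      using sol data[of "X 0"] unfolding riemann_invariants_solution_def by simp
  qed (use tx in auto)
  then show ?thesis using Xt tx by simp
qed

lemma riemann_invariants_bounded:
  assumes sol: "riemann_invariants_solution \<Lambda>m \<Lambda>p T lm lp"
    and B: "\<And>x. \<bar>\<Lambda>m x\<bar> \<le> B" "\<And>x. \<bar>\<Lambda>p x\<bar> \<le> B"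
    and z: "z \<in> {0..<T} \<times> UNIV"
  shows "\<bar>lm z\<bar> \<le> B" "\<bar>lp z\<bar> \<le> B"
proof -
  obtain t x where tx: "z = (t, x)" "0 \<le> t" "t < T" using z by auto
  have "carried_along lp lm \<Lambda>m t x" "carried_along lm lp \<Lambda>p t x"
    using sol tx unfolding riemann_invariants_solution_def by auto
  then show "\<bar>lm z\<bar> \<le> B" "\<bar>lp z\<bar> \<le> B"
    unfolding carried_along_def tx(1) using B tx(2) by (metis atLeastAtMost_iff order_refl)+
qed

section \<open>Conservation of mass\<close>

lemma integral_rescale_symmetric:
  fixes f :: "real \<Rightarrow> real"
  assumes f: "continuous_on {c - L..c + L} f" and L: "0 \<le> L"
  shows "integral {-1..1} (\<lambda>s. L * f (c + L * s)) = integral {c - L..c + L} f"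
proof -
  have "((\<lambda>s. L *\<^sub>R f (c + L * s)) has_integral integral {c + L * (-1)..c + L * 1} f) {-1..1}"
  proof (rule has_integral_substitution[where c = "c - L" and d = "c + L"])
    show "(\<lambda>s. c + L * s) ` {-1..1} \<subseteq> {c - L..c + L}"
    proof safe
      fix s :: real assume "s \<in> {-1..1}"
      then have "L * (-1) \<le> L * s" "L * s \<le> L * 1" using L by (intro mult_left_mono; auto)+
      then show "c + L * s \<in> {c - L..c + L}" by simp
    qed
    show "((\<lambda>s. c + L * s) has_field_derivative L) (at s within {-1..1})" for s
      by (auto intro!: derivative_eq_intros)
  qed (use f L in auto)
  then have "integral {-1..1} (\<lambda>s. L *\<^sub>R f (c + L * s)) = integral {c + L * (-1)..c + L * 1} f"
    by (rule integral_unique)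
  then show ?thesis unfolding real_scaleR_def by simp
qed

text \<open>No mass enters an interval whose ends move inwards at a speed \<open>B\<close> that the flow does not
  exceed. The substitution \<open>x = c + (R - B t) s\<close> fixes the interval of integration to
  \<open>[-1, 1]\<close>; the continuity equation then makes the time derivative of the integrand an
  \<open>s\<close>-derivative, namely that of \<open>-(q + B s r)\<close>, whose boundary values have a sign.\<close>

lemma mass_in_shrinking_interval:
  fixes r q :: "real \<times> real \<Rightarrow> real"
  assumes r: "C1_on ({0..<T} \<times> UNIV) r rt rx" and q: "C1_on ({0..<T} \<times> UNIV) q qt qx"
    and conserved: "\<And>z. z \<in> {0..<T} \<times> UNIV \<Longrightarrow> rt z + qx z = 0"
    and speed: "\<And>z. z \<in> {0..<T} \<times> UNIV \<Longrightarrow> \<bar>q z\<bar> \<le> B * r z"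
    and t: "0 \<le> t" "t < T" and R: "B * t \<le> R" and B: "0 \<le> B"
  shows "integral {c - (R - B * t)..c + (R - B * t)} (\<lambda>x. r (t, x))
         \<le> integral {c - R..c + R} (\<lambda>x. r (0, x))"
proof -
  let ?S = "{0..<T} \<times> (UNIV :: real set)"
  define L where "L \<tau> = R - B * \<tau>" for \<tau>
  define J where "J \<tau> s = L \<tau> * r (\<tau>, c + L \<tau> * s)" for \<tau> s
  define J' where "J' \<tau> s = L \<tau> * (rt (\<tau>, c + L \<tau> * s) * 1 + rx (\<tau>, c + L \<tau> * s) * (- B * s))
      - B * r (\<tau>, c + L \<tau> * s)" for \<tau> s
  define M where "M \<tau> = integral {-1..1} (J \<tau>)" for \<tau>
  note contr = C1_on_continuous_on[OF r]
  have contD: "continuous_on ?S rt" "continuous_on ?S rx" using r unfolding C1_on_def by auto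
  have inS: "(\<tau>, x) \<in> ?S" if "\<tau> \<in> {0..t}" for \<tau> x using that t by auto
  have slice: "continuous_on A (\<lambda>x. r (\<tau>, x))" if "\<tau> \<in> {0..t}" for \<tau> A
    using inS[OF that] by (intro continuous_on_compose2[OF contr] continuous_intros) auto
  have M_eq: "M \<tau> = integral {c - L \<tau>..c + L \<tau>} (\<lambda>x. r (\<tau>, x))" if "\<tau> \<in> {0..t}" for \<tau>
    unfolding M_def J_def
  proof (rule integral_rescale_symmetric[OF slice[OF that]])
    have "B * \<tau> \<le> B * t" using that B by (intro mult_left_mono) auto
    then show "0 \<le> L \<tau>" using R by (simp add: L_def)
  qed
  have dM: "(M has_real_derivative integral {-1..1} (J' \<tau>)) (at \<tau> within {0..t})"
    if \<tau>: "\<tau> \<in> {0..t}" for \<tau>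
    unfolding M_def
  proof (rule leibniz_rule_field_derivative[where a = "-1 :: real" and b = 1, unfolded cbox_interval])
    fix \<sigma> s :: real assume \<sigma>: "\<sigma> \<in> {0..t}"
    have dL: "(L has_real_derivative - B) (at \<sigma> within {0..t})"
      unfolding L_def by (auto intro!: derivative_eq_intros)
    have "((\<lambda>\<sigma>. c + L \<sigma> * s) has_real_derivative - B * s) (at \<sigma> within {0..t})"
      by (rule derivative_eq_intros dL refl | simp)+
    from C1_on_along_curve[OF r DERIV_ident this inS \<sigma>]
    have "((\<lambda>\<sigma>. r (\<sigma>, c + L \<sigma> * s)) has_real_derivative
        rt (\<sigma>, c + L \<sigma> * s) * 1 + rx (\<sigma>, c + L \<sigma> * s) * (- B * s)) (at \<sigma> within {0..t})" .
    from DERIV_mult[OF dL this]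
    show "((\<lambda>\<sigma>. J \<sigma> s) has_real_derivative J' \<sigma> s) (at \<sigma> within {0..t})"
      unfolding J_def J'_def by (simp add: algebra_simps)
  next
    fix \<sigma> assume \<sigma>: "\<sigma> \<in> {0..t}"
    show "J \<sigma> integrable_on {-1..1}"
      unfolding J_def using inS[OF \<sigma>]
      by (intro integrable_continuous_interval continuous_intros continuous_on_compose2[OF contr]) auto
  next
    have *: "continuous_on ({0..t} \<times> {-1..1}) (\<lambda>z. h (fst z, c + L (fst z) * snd z))"
      if "continuous_on ?S h" for h :: "real \<times> real \<Rightarrow> real"
      unfolding L_def using inS
      by (intro continuous_intros continuous_on_compose2[OF that]) auto
    have **: "continuous_on ({0..t} \<times> {-1..1}) (\<lambda>z :: real \<times> real. L (fst z))"
      unfolding L_def by (intro continuous_intros)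
    show "continuous_on ({0..t} \<times> {-1..1}) (\<lambda>(\<sigma>, s). J' \<sigma> s)"
      unfolding J'_def split_beta by (intro continuous_intros * ** contr contD)
  qed (use \<tau> in auto)
  have dM_le: "integral {-1..1} (J' \<tau>) \<le> 0" if \<tau>: "\<tau> \<in> {0..t}" for \<tau>
  proof -
    define F where "F s = - (q (\<tau>, c + L \<tau> * s) + B * s * r (\<tau>, c + L \<tau> * s))" for s
    have "(J' \<tau> has_integral F 1 - F (-1)) {-1..1}"
    proof (rule fundamental_theorem_of_calculus)
      fix s :: real assume s: "s \<in> {-1..1}"
      have lin: "((\<lambda>s. c + L \<tau> * s) has_real_derivative L \<tau>) (at s within {-1..1})"
        by (auto intro!: derivative_eq_intros)
      note d = C1_on_along_curve[OF _ DERIV_const lin inS[OF \<tau>] s]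
      have "(F has_real_derivative
          - ((qt (\<tau>, c + L \<tau> * s) * 0 + qx (\<tau>, c + L \<tau> * s) * L \<tau>)
             + ((B * 1) * r (\<tau>, c + L \<tau> * s)
                + (rt (\<tau>, c + L \<tau> * s) * 0 + rx (\<tau>, c + L \<tau> * s) * L \<tau>) * (B * s))))
          (at s within {-1..1})"
        unfolding F_def
        by (intro DERIV_minus DERIV_add DERIV_mult DERIV_cmult DERIV_ident d[OF q] d[OF r])
      moreover have "qx (\<tau>, c + L \<tau> * s) = - rt (\<tau>, c + L \<tau> * s)"
        using conserved[OF inS[OF \<tau>], of "c + L \<tau> * s"] by simp
      ultimately show "(F has_vector_derivative J' \<tau> s) (at s within {-1..1})"
        unfolding has_real_derivative_iff_has_vector_derivative[symmetric] J'_def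
        by (simp add: algebra_simps)
    qed simp
    then have "integral {-1..1} (J' \<tau>) = F 1 - F (-1)" by (rule integral_unique)
    also have "\<dots> \<le> 0"
      using speed[OF inS[OF \<tau>], of "c + L \<tau>"] speed[OF inS[OF \<tau>], of "c - L \<tau>"]
      unfolding F_def by simp
    finally show ?thesis .
  qed
  have "M t \<le> M 0"
  proof (rule DERIV_nonpos_imp_decreasing_open[OF t(1)])
    show "\<exists>y. (M has_real_derivative y) (at \<tau>) \<and> y \<le> 0" if "0 < \<tau>" "\<tau> < t" for \<tau>
      using dM[of \<tau>] dM_le[of \<tau>] that
      by (auto simp: at_within_interior[of \<tau> "{0..t}"])
    show "continuous_on {0..t} M"
      using dM by (rule DERIV_continuous_on)
  qed
  then show ?thesis using M_eq[of t] M_eq[of 0] t unfolding L_def by simp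
qed

section \<open>Integrals over small rectangles\<close>

text \<open>By Tonelli the integral of \<open>r\<close> over the rectangle is at most the length
  \<open>\<epsilon>\<close> of its time interval times the bound for the slices.\<close>

lemma nn_integral_rectangle_le:
  fixes r :: "real \<times> real \<Rightarrow> real"
  assumes r: "continuous_on ({a..<b} \<times> {c..d}) r" and nonneg: "\<And>z. z \<in> {a..<b} \<times> {c..d} \<Longrightarrow> 0 \<le> r z"
    and slice: "\<And>t. t \<in> {a..<b} \<Longrightarrow> integral {c..d} (\<lambda>x. r (t, x)) \<le> M"
    and ab: "a \<le> b"
  shows "(\<integral>\<^sup>+z. ennreal (r z) * indicator ({a..<b} \<times> {c..d}) z \<partial>lborel) \<le> ennreal M * ennreal (b - a)"
proof -
  let ?E = "{a..<b} \<times> {c..d}"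
  have E: "?E \<in> sets borel" by (simp add: borel_prod[symmetric])
  have "(\<lambda>z. indicator ?E z *\<^sub>R r z) \<in> borel_measurable borel"
    by (rule borel_measurable_continuous_on_indicator[OF E r])
  then have "(\<lambda>z. ennreal (indicator ?E z *\<^sub>R r z)) \<in> borel_measurable borel"
    by measurable
  moreover have "ennreal (indicator ?E z *\<^sub>R r z) = ennreal (r z) * indicator ?E z" for z
    by (auto simp: indicator_def)
  ultimately have meas: "(\<lambda>z. ennreal (r z) * indicator ?E z) \<in> borel_measurable (lborel \<Otimes>\<^sub>M lborel)"
    by (simp add: lborel_prod)
  have "(\<integral>\<^sup>+z. ennreal (r z) * indicator ?E z \<partial>lborel)
      = (\<integral>\<^sup>+t. \<integral>\<^sup>+x. ennreal (r (t, x)) * indicator ?E (t, x) \<partial>lborel \<partial>lborel)"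
    using lborel.nn_integral_fst[OF meas] by (simp add: lborel_prod)
  also have "\<dots> \<le> (\<integral>\<^sup>+t. ennreal M * indicator {a..<b} t \<partial>lborel)"
  proof (rule nn_integral_mono)
    fix t :: real
    show "(\<integral>\<^sup>+x. ennreal (r (t, x)) * indicator ?E (t, x) \<partial>lborel) \<le> ennreal M * indicator {a..<b} t"
    proof (cases "t \<in> {a..<b}")
      case True
      have "continuous_on {c..d} (\<lambda>x. r (t, x))"
        using True by (intro continuous_on_compose2[OF r] continuous_intros) auto
      then have "((\<lambda>x. r (t, x)) has_integral integral {c..d} (\<lambda>x. r (t, x))) {c..d}"
        by (intro integrable_integral integrable_continuous_interval)
      from nn_integral_has_integral_lebesgue'[OF _ this] nonneg True
      have "(\<integral>\<^sup>+x. ennreal (r (t, x)) * indicator {c..d} x \<partial>lborel)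
          = ennreal (integral {c..d} (\<lambda>x. r (t, x)))" by auto
      moreover have "indicator ?E (t, x) = (indicator {c..d} x :: ennreal)" for x
        using True by (auto simp: indicator_def)
      ultimately show ?thesis using slice[OF True] True by (simp add: ennreal_leI)
    qed (auto simp: indicator_def)
  qed
  also have "\<dots> = ennreal M * ennreal (b - a)"
    using ab by (simp add: nn_integral_cmult_indicator)
  finally show ?thesis .
qed

lemma integrals_vanish_of_slice_bound:
  fixes r g :: "real \<times> real \<Rightarrow> real"
  assumes T: "0 < T" and r: "continuous_on ({0..<T} \<times> UNIV) r" and g: "continuous_on ({0..<T} \<times> UNIV) g"
    and dom: "\<And>z. z \<in> {0..<T} \<times> {c - 1..c + 1} \<Longrightarrow> \<bar>g z\<bar> \<le> r z"
    and slice: "\<And>t. t \<in> {0..<T} \<Longrightarrow> integral {c - 1..c + 1} (\<lambda>x. r (t, x)) \<le> M"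
  shows "integrals_vanish (D_minus T c) g"
proof -
  \<comment> \<open>The rectangles include the line \<open>t = T\<close>, on which \<open>g\<close> is unknown, but which is a null set.\<close>
  have "AE z in lebesgue. z \<notin> {z :: real \<times> real. z \<bullet> (1, 0) = T}"
    by (intro AE_not_in) (simp add: negligible_iff_null_sets[symmetric] negligible_standard_hyperplane Basis_prod_def)
  then have top: "AE z :: real \<times> real in lebesgue. fst z \<noteq> T" by (simp add: inner_prod_def)
  have nonneg: "0 \<le> r z" if "z \<in> {0..<T} \<times> {c - 1..c + 1}" for z
    using dom[OF that] by linarith
  have M: "0 \<le> M"
  proof -
    have "continuous_on {c - 1..c + 1} (\<lambda>x. r (0, x))"
      using T by (intro continuous_on_compose2[OF r] continuous_intros) auto
    then have "0 \<le> integral {c - 1..c + 1} (\<lambda>x. r (0, x))"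
      using T by (intro integral_nonneg integrable_continuous_interval nonneg) auto
    also have "\<dots> \<le> M" using slice[of 0] T by simp
    finally show ?thesis .
  qed
  have main: "set_integrable lebesgue (D_minus T c \<epsilon>) g \<and> \<bar>LINT z:D_minus T c \<epsilon>|lebesgue. g z\<bar> \<le> M * \<epsilon>"
    if \<epsilon>: "0 < \<epsilon>" "\<epsilon> < min 1 T" for \<epsilon>
  proof -
    let ?E = "{T - \<epsilon>..<T} \<times> {c - \<epsilon>..c + \<epsilon>}"
    let ?F = "{T - \<epsilon>..<T} \<times> {c - 1..c + 1}"
    define h where "h z = indicator ?E z *\<^sub>R g z" for z
    have E: "?E \<in> sets borel" by (simp add: borel_prod[symmetric])
    have h: "h \<in> borel_measurable borel" unfolding h_def
      by (rule borel_measurable_continuous_on_indicator[OF E continuous_on_subset[OF g]]) (use \<epsilon> in auto)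
    have D: "D_minus T c \<epsilon> = {T - \<epsilon>..T} \<times> {c - \<epsilon>..c + \<epsilon>}"
      unfolding D_minus_def by (auto simp: abs_le_iff)
    have "(\<integral>\<^sup>+z. ennreal (norm (h z)) \<partial>lborel) \<le> (\<integral>\<^sup>+z. ennreal (r z) * indicator ?F z \<partial>lborel)"
    proof (rule nn_integral_mono)
      fix z
      show "ennreal (norm (h z)) \<le> ennreal (r z) * indicator ?F z"
      proof (cases "z \<in> ?E")
        case True
        then have "z \<in> ?F" using \<epsilon> by auto
        moreover from this have "\<bar>g z\<bar> \<le> r z" using \<epsilon> by (intro dom) auto
        ultimately show ?thesis using True by (simp add: h_def ennreal_leI)
      qed (simp add: h_def)
    qed
    also have "\<dots> \<le> ennreal M * ennreal (T - (T - \<epsilon>))"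
    proof (rule nn_integral_rectangle_le)
      show "0 \<le> r z" if "z \<in> ?F" for z
        using that \<epsilon> by (intro nonneg) auto
    qed (use \<epsilon> slice in \<open>auto intro: continuous_on_subset[OF r]\<close>)
    also have "\<dots> = ennreal (M * \<epsilon>)" using M \<epsilon> by (simp add: ennreal_mult)
    finally have le: "(\<integral>\<^sup>+z. ennreal (norm (h z)) \<partial>lborel) \<le> ennreal (M * \<epsilon>)" .
    have int: "integrable lborel h"
      using h le_less_trans[OF le ennreal_less_top] by (intro integrableI_bounded) simp_all
    have "ennreal (norm (integral\<^sup>L lborel h)) \<le> ennreal (M * \<epsilon>)"
      using integral_norm_bound_ennreal[OF int] le by (rule order_trans)
    then have bound: "\<bar>integral\<^sup>L lborel h\<bar> \<le> M * \<epsilon>" using M \<epsilon> by simp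
    have intc: "integrable lebesgue h" "integral\<^sup>L lebesgue h = integral\<^sup>L lborel h"
      using int h by (simp_all add: integrable_completion integral_completion)
    have ae: "AE z in lebesgue. h z = indicator (D_minus T c \<epsilon>) z *\<^sub>R g z"
      using top by eventually_elim (auto simp: h_def D indicator_def)
    have hm: "h \<in> borel_measurable lebesgue" using intc(1) by (rule borel_measurable_integrable)
    have Dm: "(\<lambda>z. indicator (D_minus T c \<epsilon>) z *\<^sub>R g z) \<in> borel_measurable lebesgue"
      using hm ae by (rule borel_measurable_AE)
    show ?thesis
      unfolding set_integrable_def set_lebesgue_integral_def
      using integrable_cong_AE[OF hm Dm ae] integral_cong_AE[OF hm Dm ae] intc bound by simp
  qed
  have ev: "\<forall>\<^sub>F \<epsilon> in at_right 0. 0 < \<epsilon> \<and> \<epsilon> < min 1 T"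
    using T by (auto simp: eventually_at_right_field intro!: exI[of _ "min 1 T"])
  show ?thesis unfolding integrals_vanish_def
  proof
    show "\<forall>\<^sub>F \<epsilon> in at_right 0. set_integrable lebesgue (D_minus T c \<epsilon>) g"
      using ev by eventually_elim (use main in auto)
    show "((\<lambda>\<epsilon>. LINT z:D_minus T c \<epsilon>|lebesgue. g z) \<longlongrightarrow> 0) (at_right 0)"
    proof (rule Lim_null_comparison)
      show "\<forall>\<^sub>F \<epsilon> in at_right 0. norm (LINT z:D_minus T c \<epsilon>|lebesgue. g z) \<le> M * \<epsilon>"
        using ev by eventually_elim (use main in auto)
      show "((\<lambda>\<epsilon>. M * \<epsilon>) \<longlongrightarrow> 0) (at_right 0)"
        by (auto intro!: tendsto_eq_intros)
    qed
  qed
qed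

section \<open>The gas before blow-up\<close>

text \<open>With \<open>w = \<lambda>\<^sub>+ - \<lambda>\<^sub>-\<close> both \<open>\<partial>\<^sub>t \<rho>\<close> and \<open>- \<partial>\<^sub>x (\<rho> u)\<close> equal
  \<open>2 \<mu> (\<lambda>\<^sub>- \<partial>\<^sub>x \<lambda>\<^sub>+ - \<lambda>\<^sub>+ \<partial>\<^sub>x \<lambda>\<^sub>-) / w\<^sup>2\<close>.\<close>

lemma continuity_equation:
  assumes sol: "riemann_invariants_solution \<Lambda>m \<Lambda>p T lm lp"
    and pos: "\<And>z. z \<in> {0..<T} \<times> UNIV \<Longrightarrow> lm z < lp z"
  obtains rt rx qt qx where
    "C1_on ({0..<T} \<times> UNIV) (gas_density \<mu> lm lp) rt rx"
    "C1_on ({0..<T} \<times> UNIV) (\<lambda>z. gas_density \<mu> lm lp z * velocity lm lp z) qt qx"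
    "\<And>z. z \<in> {0..<T} \<times> UNIV \<Longrightarrow> rt z + qx z = 0"
proof -
  let ?S = "{0..<T} \<times> (UNIV :: real set)"
  obtain mt mx pt px where m: "C1_on ?S lm mt mx" and p: "C1_on ?S lp pt px"
    and pde: "\<And>z. z \<in> ?S \<Longrightarrow> mt z + lp z * mx z = 0 \<and> pt z + lm z * px z = 0"
    using sol unfolding riemann_invariants_solution_def by blast
  define dr where "dr dm dp z = - (2 * \<mu> * (dp z - dm z)) / (lp z - lm z)\<^sup>2" for dm dp :: "real \<times> real \<Rightarrow> real" and z
  define dq where "dq dm dp z = 2 * \<mu> * (lp z * dm z - lm z * dp z) / (lp z - lm z)\<^sup>2" for dm dp :: "real \<times> real \<Rightarrow> real" and z
  note cont = C1_on_continuous_on[OF m] C1_on_continuous_on[OF p]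
  have contD: "continuous_on ?S mt" "continuous_on ?S mx" "continuous_on ?S pt" "continuous_on ?S px"
    using m p unfolding C1_on_def by auto
  have ne: "lp z - lm z \<noteq> 0" if "z \<in> ?S" for z using pos[OF that] by simp
  have dm: "(lm has_derivative (\<lambda>h. mt z * fst h + mx z * snd h)) (at z within ?S)"
    and dp: "(lp has_derivative (\<lambda>h. pt z * fst h + px z * snd h)) (at z within ?S)" if "z \<in> ?S" for z
    using m p that unfolding C1_on_def by auto
  have r: "C1_on ?S (gas_density \<mu> lm lp) (dr mt pt) (dr mx px)"
    unfolding C1_on_def
  proof (intro conjI ballI)
    fix z assume z: "z \<in> ?S"
    show "(gas_density \<mu> lm lp has_derivative (\<lambda>h. dr mt pt z * fst h + dr mx px z * snd h)) (at z within ?S)"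
      unfolding gas_density_def[abs_def]
      by (rule has_derivative_eq_rhs
          [OF has_derivative_divide'[OF has_derivative_const has_derivative_diff[OF dp[OF z] dm[OF z]] ne[OF z]]])
        (simp add: dr_def fun_eq_iff power2_eq_square add_divide_distrib[symmetric] algebra_simps)
  qed (unfold dr_def, (intro continuous_intros cont contD; use ne in simp)+)
  have q: "C1_on ?S (\<lambda>z. gas_density \<mu> lm lp z * velocity lm lp z) (dq mt pt) (dq mx px)"
    unfolding C1_on_def
  proof (intro conjI ballI)
    fix z assume z: "z \<in> ?S"
    have momentum: "(\<lambda>z. gas_density \<mu> lm lp z * velocity lm lp z)
        = (\<lambda>z. \<mu> * (lp z + lm z) / (lp z - lm z))"
    proof
      fix z
      have "2 * \<mu> / w * (v / 2) = \<mu> * v / w" for v w :: real by simp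
      then show "gas_density \<mu> lm lp z * velocity lm lp z = \<mu> * (lp z + lm z) / (lp z - lm z)"
        unfolding gas_density_def velocity_def .
    qed
    show "((\<lambda>z. gas_density \<mu> lm lp z * velocity lm lp z) has_derivative
        (\<lambda>h. dq mt pt z * fst h + dq mx px z * snd h)) (at z within ?S)"
      unfolding momentum
      by (rule has_derivative_eq_rhs
          [OF has_derivative_divide'[OF has_derivative_mult_right[OF has_derivative_add[OF dp[OF z] dm[OF z]]]
              has_derivative_diff[OF dp[OF z] dm[OF z]] ne[OF z]]])
        (simp add: dq_def fun_eq_iff power2_eq_square add_divide_distrib[symmetric] algebra_simps)
  qed (unfold dq_def, (intro continuous_intros cont contD; use ne in simp)+)
  have "dr mt pt z + dq mx px z = 0" if z: "z \<in> ?S" for z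
  proof -
    have "mt z = - lp z * mx z" "pt z = - lm z * px z" using pde[OF z] by auto
    then show ?thesis by (simp add: dr_def dq_def add_divide_distrib[symmetric] algebra_simps)
  qed
  with r q show thesis by (rule that)
qed

lemma blowup_time_pos:
  assumes "continuous_on UNIV \<Lambda>m" "continuous_on UNIV \<Lambda>p"
    and "\<And>x. \<Lambda>m x < \<Lambda>p x" and "\<alpha> < \<beta>"
  shows "0 < blowup_time \<Lambda>m \<Lambda>p \<alpha> \<beta>"
proof -
  have "continuous_on {\<alpha>..\<beta>} (\<lambda>x. 1 / (\<Lambda>p x - \<Lambda>m x))"
    using assms(3) by (intro continuous_intros continuous_on_subset[OF assms(1)]
        continuous_on_subset[OF assms(2)]) (auto simp: less_imp_neq[symmetric])
  then have "integral {\<alpha>..\<beta>} (\<lambda>x. 0) < integral {\<alpha>..\<beta>} (\<lambda>x. 1 / (\<Lambda>p x - \<Lambda>m x))"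
    using assms by (intro integral_less_real) auto
  then show ?thesis by (simp add: blowup_time_def)
qed

theorem theorem5p1:
  fixes p0 \<mu> :: real
    and \<rho>0 u0 \<Lambda>m \<Lambda>p :: "real \<Rightarrow> real"
    and \<alpha>0 \<beta>0 t0 x0 :: real
    and lm lp \<rho> u \<phi> \<phi>t \<phi>x :: "real \<times> real \<Rightarrow> real"
  assumes "p0 > 0" and "\<mu> > 0"
    and "\<And>x. \<rho>0 x > 0"
    and "\<Lambda>m = (\<lambda>x. u0 x - \<mu> / \<rho>0 x)" and "\<Lambda>p = (\<lambda>x. u0 x + \<mu> / \<rho>0 x)"
    and "C2_bounded \<rho>0" and "C2_bounded u0" and "C2_bounded \<Lambda>m" and "C2_bounded \<Lambda>p"
    and "\<And>x. \<Lambda>m x < \<Lambda>p x"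
    and "\<And>x. deriv \<Lambda>m x < 0" and "\<And>x. deriv \<Lambda>p x < 0"
    and "\<alpha>0 < \<beta>0" and "\<Lambda>m \<alpha>0 = \<Lambda>p \<beta>0"
    and "blowup_fun \<Lambda>m \<Lambda>p \<alpha>0 = 0" and "deriv (blowup_fun \<Lambda>m \<Lambda>p) \<alpha>0 < 0"
    and "t0 = blowup_time \<Lambda>m \<Lambda>p \<alpha>0 \<beta>0" and "x0 = blowup_place \<Lambda>m \<Lambda>p \<alpha>0 \<beta>0"
    and "riemann_invariants_solution \<Lambda>m \<Lambda>p t0 lm lp"
    and "\<rho> = gas_density \<mu> lm lp" and "u = velocity lm lp"
    and "test_function \<phi> \<phi>t \<phi>x"
  shows "integrals_vanish (D_minus t0 x0) (\<lambda>z. \<rho> z * \<phi>t z + \<rho> z * u z * \<phi>x z)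
       \<and> integrals_vanish (D_minus t0 x0)
           (\<lambda>z. \<rho> z * u z * \<phi>t z + (\<rho> z * (u z)\<^sup>2 + pressure p0 \<mu> (\<rho> z)) * \<phi>x z)"
proof -
  let ?S = "{0..<t0} \<times> (UNIV :: real set)"
  note \<rho> = \<open>\<rho> = gas_density \<mu> lm lp\<close> and u = \<open>u = velocity lm lp\<close> and \<mu> = \<open>\<mu> > 0\<close> and p0 = \<open>p0 > 0\<close>
  note sol = \<open>riemann_invariants_solution \<Lambda>m \<Lambda>p t0 lm lp\<close>
  have cont\<Lambda>: "continuous_on UNIV g" if "C2_bounded g" for g
    using that unfolding C2_bounded_def
    by (simp add: continuous_at_imp_continuous_on field_differentiable_imp_continuous_at)
  have t0: "0 < t0"
    using blowup_time_pos[OF cont\<Lambda> cont\<Lambda>] assms by metis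
  obtain Bm Bp where "\<And>x. \<bar>\<Lambda>m x\<bar> \<le> Bm" "\<And>x. \<bar>\<Lambda>p x\<bar> \<le> Bp"
    using \<open>C2_bounded \<Lambda>m\<close> \<open>C2_bounded \<Lambda>p\<close> unfolding C2_bounded_def bounded_iff by auto
  moreover define B where "B = max Bm Bp"
  ultimately have "\<And>x. \<bar>\<Lambda>m x\<bar> \<le> B" "\<And>x. \<bar>\<Lambda>p x\<bar> \<le> B" by (simp_all add: le_max_iff_disj)
  note Bz = riemann_invariants_bounded[OF sol this]
  have B0: "0 \<le> B" using \<open>\<And>x. \<bar>\<Lambda>m x\<bar> \<le> B\<close>[of 0] by linarith
  note pos = riemann_invariants_strict[OF sol \<open>\<And>x. \<Lambda>m x < \<Lambda>p x\<close>]
  have \<rho>pos: "0 < \<rho> z" if "z \<in> ?S" for z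
    using pos[OF that] \<mu> by (simp add: \<rho> gas_density_def)
  have uB: "\<bar>u z\<bar> \<le> B" if "z \<in> ?S" for z
    using Bz[OF that] by (simp add: u velocity_def abs_le_iff)
  \<comment> \<open>The pressure depends linearly on the gap between the invariants, so it stays bounded even
    where the density is large.\<close>
  have pB: "\<bar>pressure p0 \<mu> (\<rho> z)\<bar> \<le> p0 + \<mu> * B" if z: "z \<in> ?S" for z
  proof -
    have "\<mu>\<^sup>2 / \<rho> z = \<mu> * ((lp z - lm z) / 2)"
      using \<mu> pos[OF z] by (simp add: \<rho> gas_density_def power2_eq_square field_simps)
    moreover have "\<mu> * ((lp z - lm z) / 2) \<le> \<mu> * B" "0 \<le> \<mu> * ((lp z - lm z) / 2)"
      using Bz[OF z] pos[OF z] \<mu> by (auto intro!: mult_left_mono)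
    ultimately show ?thesis using p0 unfolding pressure_def by linarith
  qed
  obtain rt rx qt qx where r: "C1_on ?S \<rho> rt rx" and q: "C1_on ?S (\<lambda>z. \<rho> z * u z) qt qx"
    and conserved: "\<And>z. z \<in> ?S \<Longrightarrow> rt z + qx z = 0"
    using continuity_equation[OF sol pos, of \<mu>] unfolding \<rho> u by blast
  note cont\<rho> = C1_on_continuous_on[OF r]
  have contl: "continuous_on ?S lm" "continuous_on ?S lp"
    using sol C1_on_continuous_on unfolding riemann_invariants_solution_def by blast+
  have contu: "continuous_on ?S u"
    unfolding u velocity_def[abs_def] by (intro continuous_intros contl) simp
  \<comment> \<open>An interval that starts with half width \<open>R\<close> and shrinks at speed \<open>B\<close> on both sides still
    contains \<open>[x0 - 1, x0 + 1]\<close> at every time before \<open>t0\<close>.\<close>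
  define R where "R = B * t0 + 1"
  define M where "M = integral {x0 - R..x0 + R} (\<lambda>x. \<rho> (0, x))"
  have slice: "continuous_on A (\<lambda>x. \<rho> (t, x))" if "t \<in> {0..<t0}" for t A
    using that by (intro continuous_on_compose2[OF cont\<rho>] continuous_intros) auto
  have mass: "integral {x0 - 1..x0 + 1} (\<lambda>x. \<rho> (t, x)) \<le> M" if t: "t \<in> {0..<t0}" for t
  proof -
    have Bt: "B * t \<le> B * t0" using t B0 by (intro mult_left_mono) auto
    have "integral {x0 - 1..x0 + 1} (\<lambda>x. \<rho> (t, x))
        \<le> integral {x0 - (R - B * t)..x0 + (R - B * t)} (\<lambda>x. \<rho> (t, x))"
      using Bt \<rho>pos t
      by (intro integral_subset_le integrable_continuous_interval slice) (auto simp: R_def less_imp_le)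
    also have "\<dots> \<le> M" unfolding M_def
    proof (rule mass_in_shrinking_interval[OF r q conserved])
      show "\<bar>\<rho> z * u z\<bar> \<le> B * \<rho> z" if z: "z \<in> ?S" for z
        using mult_left_mono[OF uB[OF z], of "\<rho> z"] \<rho>pos[OF z] by (simp add: abs_mult mult.commute)
    qed (use t B0 Bt in \<open>auto simp: R_def\<close>)
    finally show ?thesis .
  qed
  have cont\<phi>: "continuous_on ({0..} \<times> UNIV) \<phi>t" "continuous_on ({0..} \<times> UNIV) \<phi>x"
    using \<open>test_function \<phi> \<phi>t \<phi>x\<close> unfolding test_function_def C1_on_def by auto
  let ?Q = "{0..t0} \<times> {x0 - 1..x0 + 1}"
  have "bounded (\<phi>t ` ?Q)" "bounded (\<phi>x ` ?Q)"
    by (intro compact_imp_bounded compact_continuous_image compact_Times compact_Icc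
        continuous_on_subset[OF cont\<phi>(1)] continuous_on_subset[OF cont\<phi>(2)]; auto)+
  then obtain Kt Kx where "\<And>z. z \<in> ?Q \<Longrightarrow> \<bar>\<phi>t z\<bar> \<le> Kt" "\<And>z. z \<in> ?Q \<Longrightarrow> \<bar>\<phi>x z\<bar> \<le> Kx"
    unfolding bounded_iff ball_simps real_norm_def by metis
  moreover define K where "K = max 0 (max Kt Kx)"
  ultimately have K: "\<And>z. z \<in> ?Q \<Longrightarrow> \<bar>\<phi>t z\<bar> \<le> K" "\<And>z. z \<in> ?Q \<Longrightarrow> \<bar>\<phi>x z\<bar> \<le> K" and K0: "0 \<le> K"
    by (simp_all add: le_max_iff_disj del: mem_Times_iff)
  have cont\<phi>S: "continuous_on ?S \<phi>t" "continuous_on ?S \<phi>x"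
    by (rule continuous_on_subset[OF cont\<phi>(1)] continuous_on_subset[OF cont\<phi>(2)]; auto)+
  \<comment> \<open>A flux pairing \<open>a \<phi>\<^sub>t + b \<phi>\<^sub>x\<close> whose coefficients grow at most like \<open>1 + \<rho>\<close>
    has vanishing integrals.\<close>
  have vanish: "integrals_vanish (D_minus t0 x0) (\<lambda>z. a z * \<phi>t z + b z * \<phi>x z)"
    if a: "continuous_on ?S a" "\<And>z. z \<in> ?S \<Longrightarrow> \<bar>a z\<bar> \<le> C * (1 + \<rho> z)"
      and b: "continuous_on ?S b" "\<And>z. z \<in> ?S \<Longrightarrow> \<bar>b z\<bar> \<le> C * (1 + \<rho> z)"
      and C: "0 \<le> C" for a b C
  proof (rule integrals_vanish_of_slice_bound[OF t0])
    let ?r = "\<lambda>z. 2 * K * C * (1 + \<rho> z)"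
    show "continuous_on ?S ?r" by (intro continuous_intros cont\<rho>)
    show "continuous_on ?S (\<lambda>z. a z * \<phi>t z + b z * \<phi>x z)" by (intro continuous_intros a b cont\<phi>S)
    fix z assume z: "z \<in> {0..<t0} \<times> {x0 - 1..x0 + 1}"
    then have "z \<in> ?S" "z \<in> ?Q" by auto
    then have "\<bar>a z\<bar> * \<bar>\<phi>t z\<bar> \<le> C * (1 + \<rho> z) * K" "\<bar>b z\<bar> * \<bar>\<phi>x z\<bar> \<le> C * (1 + \<rho> z) * K"
      using a(2)[of z] b(2)[of z] K[of z] C \<rho>pos[of z] by (auto intro!: mult_mono)
    then have "\<bar>a z * \<phi>t z\<bar> \<le> C * (1 + \<rho> z) * K" "\<bar>b z * \<phi>x z\<bar> \<le> C * (1 + \<rho> z) * K"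
      by (simp_all add: abs_mult)
    then have "\<bar>a z * \<phi>t z + b z * \<phi>x z\<bar> \<le> C * (1 + \<rho> z) * K + C * (1 + \<rho> z) * K" by linarith
    then show "\<bar>a z * \<phi>t z + b z * \<phi>x z\<bar> \<le> ?r z" by (simp add: algebra_simps)
  next
    fix t assume t: "t \<in> {0..<t0}"
    have "integral {x0 - 1..x0 + 1} (\<lambda>x. 2 * K * C * (1 + \<rho> (t, x)))
        = 2 * K * C * (2 + integral {x0 - 1..x0 + 1} (\<lambda>x. \<rho> (t, x)))"
      using slice[OF t] by (simp add: integral_add integrable_continuous_interval)
    also have "\<dots> \<le> 2 * K * C * (2 + M)"
      using mass[OF t] K0 C by (intro mult_left_mono) auto
    finally show "integral {x0 - 1..x0 + 1} (\<lambda>x. 2 * K * C * (1 + \<rho> (t, x))) \<le> 2 * K * C * (2 + M)" .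
  qed
  define C where "C = 1 + B + B\<^sup>2 + p0 + \<mu> * B"
  have C: "0 \<le> C" "1 \<le> C" "B \<le> C" "B\<^sup>2 + (p0 + \<mu> * B) \<le> C"
    using B0 p0 \<mu> by (simp_all add: C_def)
  have grow: "\<bar>\<rho> z * b\<bar> \<le> C * (1 + \<rho> z)" if z: "z \<in> ?S" and b: "\<bar>b\<bar> \<le> C" for z b
  proof -
    have "\<bar>\<rho> z * b\<bar> \<le> \<rho> z * C" using b \<rho>pos[OF z] by (simp add: abs_mult)
    then show ?thesis using C by (simp add: algebra_simps)
  qed
  have mass_bd: "\<bar>\<rho> z\<bar> \<le> C * (1 + \<rho> z)" if z: "z \<in> ?S" for z
    using grow[OF z, of 1] C by simp
  have mom_bd: "\<bar>\<rho> z * u z\<bar> \<le> C * (1 + \<rho> z)" if z: "z \<in> ?S" for z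
    using grow[OF z, of "u z"] uB[OF z] C by simp
  have flux_bd: "\<bar>\<rho> z * (u z)\<^sup>2 + pressure p0 \<mu> (\<rho> z)\<bar> \<le> C * (1 + \<rho> z)" if z: "z \<in> ?S" for z
  proof -
    have "\<rho> z * (u z)\<^sup>2 \<le> \<rho> z * B\<^sup>2"
      using power_mono[OF uB[OF z], of 2] \<rho>pos[OF z] by (intro mult_left_mono) auto
    also have "\<dots> \<le> \<rho> z * C" using C \<rho>pos[OF z] p0 \<mu> B0 by (simp add: C_def)
    finally have "\<rho> z * (u z)\<^sup>2 \<le> \<rho> z * C" .
    moreover have "0 \<le> \<rho> z * (u z)\<^sup>2" using \<rho>pos[OF z] by simp
    moreover have "\<bar>pressure p0 \<mu> (\<rho> z)\<bar> \<le> C" using pB[OF z] C(4) zero_le_power2[of B] by linarith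
    ultimately show ?thesis by (simp add: algebra_simps)
  qed
  have cont_flux: "continuous_on ?S (\<lambda>z. \<rho> z * (u z)\<^sup>2 + pressure p0 \<mu> (\<rho> z))"
    unfolding pressure_def by (intro continuous_intros cont\<rho> contu) (metis \<rho>pos less_irrefl)
  show ?thesis
    using vanish[OF cont\<rho> mass_bd C1_on_continuous_on[OF q] mom_bd C(1)]
      vanish[OF C1_on_continuous_on[OF q] mom_bd cont_flux flux_bd C(1)] by blast
qed

end
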